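(* Let $q$ be a prime power, $s\ge 2$ an even integer, and $n_1=(q^s+1)n_2$, where $n_2$ is a positive integer dividing $q^s-1$. Let $0=a'_0<a'_1<\dots<a'_{\nu'}$ be the minimum representatives of the cyclotomic cosets modulo $n_1$ with respect to $q^2$, and let $1\le\tau'\le\nu'$. Then the BCH code $\mathrm{BCH}^{n_1}(1,\tau')$ over $\mathbb{F}_{q^2}$ is Hermitian self-orthogonal if and only if $$a'_{\tau'}\le qn_2-\min\left\{\left\lfloor\frac{(q-1)n_2}{q^{s-1}+1}\right\rfloor,\ \left\lfloor\frac{(q-1)n_2-1}{q^{s-1}}\right\rfloor\right\}-1.$$
   Context: Let $n_1\mid q^{2s}-1$ and $E(n_1)=\{0,1,\dots,n_1-1\}$, regarded as a set of representatives of $\mathbb{Z}/n_1\mathbb{Z}$. The cyclotomic cosets in $E(n_1)$ with respect to $q^2$ are the sets $\{q^{2i}e\bmod n_1: i\ge 0\}$, $e\in E(n_1)$; $\Lambda'_a$ denotes the coset with minimum element $a$. Let $U(n_1)=\{\beta_1,\dots,\beta_{n_1}\}\subset\mathbb{F}_{q^{2s}}$ be the zeros of $X^{n_1}-1$, and for $\Delta\subseteq E(n_1)$ let $\mathcal{C}^{U(n_1)}_\Delta\subseteq\mathbb{F}_{q^{2s}}^{n_1}$ be the $\mathbb{F}_{q^{2s}}$-span of the vectors $(\beta_1^e,\dots,\beta_{n_1}^e)$, $e\in\Delta$. Then $\mathrm{BCH}^{n_1}(1,\tau')=\mathcal{C}^{U(n_1)}_{\Delta}\cap\mathbb{F}_{q^2}^{n_1}$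 with $\Delta=\Lambda'_{a'_1}\cup\dots\cup\Lambda'_{a'_{\tau'}}$. A linear code $\mathcal{C}\subseteq\mathbb{F}_{q^2}^{n_1}$ is Hermitian self-orthogonal if $\sum_i x_iy_i^q=0$ for all $\boldsymbol{x},\boldsymbol{y}\in\mathcal{C}$. *)

theory Defs
  imports
    "HOL-Analysis.Cartesian_Space"
    "HOL-Number_Theory.Prime_Powers"
begin

definition is_subfield :: "'a::field set \<Rightarrow> bool" where
  "is_subfield F \<longleftrightarrow>
     0 \<in> F \<and> 1 \<in> F \<and>
     (\<forall>x\<in>F. \<forall>y\<in>F. x + y \<in> F \<and> x * y \<in> F) \<and>
     (\<forall>x\<in>F. - x \<in> F \<and> inverse x \<in> F)"

text \<open>Cosets are taken with respect to \<open>q\<^sup>2\<close>, not \<open>q\<close>.\<close>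

definition cyclotomic_coset :: "nat \<Rightarrow> nat \<Rightarrow> nat \<Rightarrow> nat set" where
  "cyclotomic_coset q n e = {q ^ (2 * i) * e mod n | i. True}"

definition cyclotomic_cosets :: "nat \<Rightarrow> nat \<Rightarrow> nat set set" where
  "cyclotomic_cosets q n = cyclotomic_coset q n ` {0..<n}"

text \<open>Codes of length \<open>n\<close> over \<open>'a\<close> are subsets of \<open>'a ^ 'n\<close> with \<open>CARD('n) = n\<close>.
  A function \<open>\<beta>\<close> lists the evaluation points, the zeros of \<open>X ^ n - 1\<close>, in some order.\<close>

definition eval_code :: "('n::finite \<Rightarrow> 'a::field) \<Rightarrow> nat set \<Rightarrow> ('a ^ 'n) set" where
  "eval_code \<beta> \<Delta> = vec.span ((\<lambda>e. \<chi> i. \<beta> i ^ e) ` \<Delta>)"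

definition subfield_subcode :: "'a set \<Rightarrow> ('a ^ 'n::finite) set \<Rightarrow> ('a ^ 'n) set" where
  "subfield_subcode F C = C \<inter> {x. \<forall>i. x $ i \<in> F}"

text \<open>Here \<open>F\<close> is the subfield with \<open>q\<^sup>2\<close> elements and \<open>a t\<close> is the minimum of the
  \<open>t\<close>-th cyclotomic coset. As \<open>q\<close> is coprime to the length, the cosets form a partition, so the
  coset with minimum element \<open>a t\<close> is the one generated by \<open>a t\<close>. The union starts at \<open>t = 1\<close>,
  so the coset of \<open>0\<close> is left out.\<close>

definition BCH_code ::
  "'a::field set \<Rightarrow> ('n::finite \<Rightarrow> 'a) \<Rightarrow> nat \<Rightarrow> (nat \<Rightarrow> nat) \<Rightarrow> nat \<Rightarrow> ('a ^ 'n) set" where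
  "BCH_code F \<beta> q a \<tau> =
     subfield_subcode F (eval_code \<beta> (\<Union>t\<in>{1..\<tau>}. cyclotomic_coset q CARD('n) (a t)))"

definition hermitian_self_orthogonal :: "nat \<Rightarrow> ('a::field ^ 'n::finite) set \<Rightarrow> bool" where
  "hermitian_self_orthogonal q C \<longleftrightarrow> (\<forall>x\<in>C. \<forall>y\<in>C. (\<Sum>i\<in>UNIV. x $ i * (y $ i) ^ q) = 0)"

end

theory Submission
  imports
    Defs
    "HOL-Computational_Algebra.Polynomial"
    "HOL-Number_Theory.Cong"
begin

text \<open>Let \<open>\<Delta>\<close> be the defining set of the code. As \<open>\<Delta>\<close> is stable under \<open>q\<^sup>2\<close>, traces show that the
  subfield subcode spans the evaluation code, so it is Hermitian self-orthogonal iff no sum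
  \<open>e + q * e'\<close> with \<open>e\<close>, \<open>e'\<close> in \<open>\<Delta>\<close> is divisible by the length \<open>n\<^sub>1\<close>. Passing to coset minima,
  such a divisibility becomes \<open>n\<^sub>1 dvd a + q ^ j * b\<close> with \<open>j\<close> odd and \<open>j < s\<close>. If \<open>a\<close> and \<open>b\<close> are less
  than \<open>q * n\<^sub>2\<close>, the size of \<open>a + q ^ j * b\<close> forces \<open>j = s - 1\<close> and \<open>a + q ^ j * b = n\<^sub>1\<close>, that is
  \<open>a = n\<^sub>2 + q ^ (s - 1) * d\<close> and \<open>b = q * n\<^sub>2 - d\<close>. The maximum of these two is smallest at the largest \<open>d\<close>
  with \<open>a \<le> b\<close>, which is the first of the two floors; the second floor is never smaller than
  the first.\<close>

section \<open>Finite fields\<close>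

lemma is_subfield_UNIV: "is_subfield UNIV"
  by (simp add: is_subfield_def)

text \<open>Multiplication by a nonzero \<open>x\<close> permutes \<open>F - {0}\<close>; comparing
  the products over this set gives \<open>x ^ card (F - {0}) = 1\<close>.\<close>

lemma subfield_power_card:
  fixes F :: "'a::field set"
  assumes F: "is_subfield F" and fin: "finite F" and x: "x \<in> F"
  shows "x ^ card F = x"
proof (cases "x = 0")
  case True
  moreover have "card F > 0"
    using fin x by (auto simp: card_gt_0_iff)
  ultimately show ?thesis by simp
next
  case False
  have closed: "y * z \<in> F" "inverse y \<in> F" if "y \<in> F" "z \<in> F" for y z
    using F that by (auto simp: is_subfield_def)
  have card: "card F = Suc (card (F - {0}))"
    using F fin by (intro card.remove) (auto simp: is_subfield_def)
  have "(\<Prod>y\<in>F-{0}. y) = (\<Prod>y\<in>F-{0}. x * y)"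
    by (rule prod.reindex_bij_witness[of _ "\<lambda>y. x * y" "\<lambda>y. inverse x * y"])
       (use False closed x in auto)
  also have "\<dots> = x ^ card (F - {0}) * (\<Prod>y\<in>F-{0}. y)"
    by (simp add: prod.distrib)
  finally have "x ^ card (F - {0}) = 1"
    using fin by simp
  then show ?thesis
    by (simp add: card)
qed

lemma power_CARD_eq_same:
  fixes x :: "'a::{field,finite}"
  shows "x ^ CARD('a) = x"
  by (rule subfield_power_card) (auto simp: is_subfield_UNIV)

text \<open>Translation by 1 permutes the field, so adding 1 to every element leaves the sum of all
  elements unchanged.\<close>

lemma of_nat_CARD_eq_0: "of_nat CARD('a) = (0 :: 'a::{field,finite})"
proof -
  have "(\<Sum>x\<in>UNIV. x) = (\<Sum>x\<in>UNIV. x + 1 :: 'a)"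
    by (rule sum.reindex_bij_witness[of _ "\<lambda>x. x + 1" "\<lambda>x. x - 1"]) auto
  then show ?thesis
    by (simp add: sum.distrib)
qed

lemma CHAR_eq_prime:
  assumes "prime p" and "CARD('a::{field,finite}) = p ^ k"
  shows "CHAR('a) = p"
proof -
  have "CHAR('a) dvd p ^ k"
    using of_nat_CARD_eq_0[where ?'a = 'a] assms(2) by (simp flip: of_nat_eq_0_iff_char_dvd)
  moreover have "prime CHAR('a)"
    by (intro prime_CHAR_semidom finite_imp_CHAR_pos) auto
  ultimately show ?thesis
    using assms(1) by (metis prime_dvd_power primes_dvd_imp_eq)
qed

text \<open>\<open>q\<close> is a power of the characteristic, so raising to \<open>q ^ i\<close> is
  an iterated Frobenius map, hence additive.\<close>

lemma sum_power_primepow: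
  fixes f :: "'b \<Rightarrow> 'a::{field,finite}"
  assumes "primepow q" and "CARD('a) = q ^ m"
  shows "(\<Sum>x\<in>A. f x) ^ (q ^ i) = (\<Sum>x\<in>A. f x ^ (q ^ i))"
proof -
  obtain p k where pk: "prime p" "q = p ^ k"
    using assms(1) by (auto simp: primepow_def)
  have "CHAR('a) = p"
    by (rule CHAR_eq_prime[of _ "k * m"]) (use pk assms(2) in \<open>auto simp: power_mult\<close>)
  then show ?thesis
    using pk by (intro freshmans_dream_sum'[where n = "k * i"]) (auto simp: power_mult)
qed

lemma add_power_primepow:
  fixes x y :: "'a::{field,finite}"
  assumes "primepow q" and "CARD('a) = q ^ m"
  shows "(x + y) ^ q = x ^ q + y ^ q"
  using sum_power_primepow[OF assms, of "\<lambda>b. if b then x else y" UNIV 1]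
  by (simp add: UNIV_bool add_ac)

lemma card_power_eq_power_le:
  assumes "m < n"
  shows "card {x :: 'a::{comm_ring_1,ring_no_zero_divisors}. x ^ n = x ^ m} \<le> n"
proof -
  let ?p = "monom 1 n - monom 1 m :: 'a poly"
  have "coeff ?p n = 1"
    using assms by simp
  then have "?p \<noteq> 0" by (metis coeff_0 zero_neq_one)
  then have "card {x. poly ?p x = 0} \<le> degree ?p"
    by (rule card_poly_roots_bound)
  also have "\<dots> \<le> n"
    using assms by (intro degree_diff_le degree_monom_le[THEN order_trans]) auto
  finally show ?thesis
    by (simp add: poly_monom)
qed

text \<open>\<open>F\<close> lies among the roots of \<open>X ^ card F - X\<close>, and there are at
  most \<open>card F\<close> of them. Traces are later recognized as elements of \<open>F\<close>
  this way.\<close>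

lemma subfield_eq_fixed_points:
  fixes F :: "'a::{field,finite} set"
  assumes "is_subfield F"
  shows "F = {x. x ^ card F = x}"
proof (rule card_seteq)
  have "{0, 1} \<subseteq> F"
    using assms by (auto simp: is_subfield_def)
  then have "card {0, 1::'a} \<le> card F"
    by (intro card_mono) auto
  then have gt: "card F > 1" by simp
  show "card {x::'a. x ^ card F = x} \<le> card F"
    using card_power_eq_power_le[OF gt, where ?'a = 'a] by simp
qed (use subfield_power_card[OF assms] in auto)

text \<open>Distinct exponents keep \<open>c k\<close> from cancelling, and a nonzero polynomial of
  degree below the field size cannot vanish everywhere.\<close>

lemma monomial_sum_nonzero:
  fixes c :: "'b \<Rightarrow> 'a::{field,finite}"
  assumes "finite K" and "inj_on f K" and "\<And>k. k \<in> K \<Longrightarrow> f k < CARD('a)"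
    and "k \<in> K" and "c k \<noteq> 0"
  shows "\<exists>x. (\<Sum>k\<in>K. c k * x ^ f k) \<noteq> 0"
proof (rule ccontr)
  assume *: "\<not> ?thesis"
  define p where "p = (\<Sum>k\<in>K. monom (c k) (f k))"
  have "coeff p (f k) = (\<Sum>k'\<in>K. if k' = k then c k' else 0)"
    unfolding p_def coeff_sum
    by (rule sum.cong) (use assms in \<open>auto dest: inj_onD\<close>)
  also have "\<dots> = c k"
    using assms by simp
  finally have "p \<noteq> 0"
    using assms(5) by auto
  have "{x. poly p x = 0} = UNIV"
    using * by (auto simp: p_def poly_sum poly_monom)
  then have "CARD('a) \<le> degree p"
    using card_poly_roots_bound[OF \<open>p \<noteq> 0\<close>] by simp
  moreover have "degree p < CARD('a)"
    unfolding p_def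
    by (rule degree_sum_less) (auto intro: le_less_trans[OF degree_monom_le assms(3)])
  ultimately show False by simp
qed

lemma power_mod_exponent:
  fixes x :: "'a::monoid_mult"
  assumes "x ^ n = 1"
  shows "x ^ (m mod n) = x ^ m"
proof -
  have "x ^ m = x ^ (n * (m div n) + m mod n)"
    by simp
  also have "\<dots> = x ^ (m mod n)"
    unfolding power_add power_mult using assms by simp
  finally show ?thesis ..
qed

text \<open>Multiplication by a root of unity \<open>g\<close> with \<open>g ^ m \<noteq> 1\<close>
  permutes the roots but scales the sum by \<open>g ^ m\<close>.\<close>

lemma sum_roots_of_unity_power:
  assumes card: "card {x::'a::{field,finite}. x ^ n = 1} = n" and "\<not> n dvd m"
  shows "(\<Sum>x | x ^ n = 1. x ^ m) = (0 :: 'a)"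
proof -
  let ?U = "{x::'a. x ^ n = 1}"
  have "n > 0"
    using card by (metis (mono_tags, lifting) card_gt_0_iff empty_iff finite mem_Collect_eq power_one)
  have "\<exists>g\<in>?U. g ^ m \<noteq> 1"
  proof (rule ccontr)
    assume *: "\<not> ?thesis"
    define r where "r = m mod n"
    have r: "0 < r" "r < n"
      using assms(2) \<open>n > 0\<close> by (auto simp: r_def dvd_eq_mod_eq_0)
    \<comment> \<open>Without such a \<open>g\<close>, all \<open>n\<close> roots of unity would be
      zeros of \<open>X ^ r - 1\<close>, where \<open>0 < r < n\<close>.\<close>
    have "?U \<subseteq> {x. x ^ r = x ^ 0}"
      using * by (auto simp: r_def power_mod_exponent)
    then have "n \<le> card {x::'a. x ^ r = x ^ 0}"
      using card by (metis (no_types, lifting) card_mono finite)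
    also have "\<dots> \<le> r"
      using r by (intro card_power_eq_power_le)
    finally show False using r by simp
  qed
  then obtain g where g: "g \<in> ?U" "g ^ m \<noteq> 1" by blast
  have "g \<noteq> 0"
    using g(1) \<open>n > 0\<close> by (auto simp: power_0_left)
  have "(\<Sum>x\<in>?U. x ^ m) = (\<Sum>x\<in>?U. (g * x) ^ m)"
    by (rule sum.reindex_bij_witness[of _ "\<lambda>x. g * x" "\<lambda>x. inverse g * x"])
       (use g \<open>g \<noteq> 0\<close> in \<open>auto simp: power_mult_distrib power_inverse\<close>)
  also have "\<dots> = g ^ m * (\<Sum>x\<in>?U. x ^ m)"
    by (simp add: power_mult_distrib sum_distrib_left)
  finally show ?thesis
    using g(2) by simp
qed

section \<open>Hermitian self-orthogonality of subfield subcodes\<close>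

text \<open>The form is linear in \<open>x\<close> and, as \<open>q\<close>-th powers are additive,
  semilinear in \<open>y\<close>. So it is enough to check generators, where it is a power sum of
  the \<open>\<beta> i\<close>.\<close>

lemma hermitian_form_eval_code:
  fixes \<beta> :: "'n::finite \<Rightarrow> 'a::{field,finite}"
  assumes q: "primepow q" "CARD('a) = q ^ m"
    and vanish: "\<And>e e'. e \<in> \<Delta> \<Longrightarrow> e' \<in> \<Delta> \<Longrightarrow> (\<Sum>i\<in>UNIV. \<beta> i ^ (e + q * e')) = 0"
    and x: "x \<in> eval_code \<beta> \<Delta>" and y: "y \<in> eval_code \<beta> \<Delta>"
  shows "(\<Sum>i\<in>UNIV. x $ i * (y $ i) ^ q) = 0"
proof -
  have q0: "q > 0"
    using primepow_gt_Suc_0[OF q(1)] by simp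
  have inner: "(\<Sum>i\<in>UNIV. \<beta> i ^ e * (y $ i) ^ q) = 0" if e: "e \<in> \<Delta>" for e
    using y unfolding eval_code_def
  proof (induction rule: vec.span_induct_alt)
    case base
    then show ?case using q0 by (simp add: power_0_left)
  next
    case (step c v y)
    then obtain e' where e': "e' \<in> \<Delta>" "v = (\<chi> i. \<beta> i ^ e')" by auto
    have "(\<Sum>i\<in>UNIV. \<beta> i ^ e * ((c *s v + y) $ i) ^ q) =
      c ^ q * (\<Sum>i\<in>UNIV. \<beta> i ^ (e + q * e')) + (\<Sum>i\<in>UNIV. \<beta> i ^ e * (y $ i) ^ q)"
      by (simp add: e' add_power_primepow[OF q] power_mult_distrib distrib_left sum.distrib
          sum_distrib_left power_add power_mult[symmetric] mult_ac)
    then show ?case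
      using step vanish[OF e e'(1)] by simp
  qed
  show ?thesis
    using x unfolding eval_code_def
  proof (induction rule: vec.span_induct_alt)
    case base
    then show ?case by simp
  next
    case (step c v x)
    then obtain e where e: "e \<in> \<Delta>" "v = (\<chi> i. \<beta> i ^ e)" by auto
    have "(\<Sum>i\<in>UNIV. (c *s v + x) $ i * (y $ i) ^ q) =
      c * (\<Sum>i\<in>UNIV. \<beta> i ^ e * (y $ i) ^ q) + (\<Sum>i\<in>UNIV. x $ i * (y $ i) ^ q)"
      by (simp add: e distrib_right sum.distrib sum_distrib_left mult.assoc)
    then show ?case
      using step inner[OF e(1)] by simp
  qed
qed

text \<open>Raising to the power \<open>q ^ 2\<close> shifts the summands of the trace cyclically,
  because \<open>w ^ (q ^ (2 * s)) = w\<close>.\<close>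

lemma trace_in_subfield:
  fixes F :: "'a::{field,finite} set"
  assumes q: "primepow q" "CARD('a) = q ^ (2 * s)"
    and F: "is_subfield F" "card F = q ^ 2"
  shows "(\<Sum>k<s. w ^ (q ^ (2 * k))) \<in> F"
proof -
  define f where "f k = w ^ (q ^ (2 * k))" for k
  have "f s = f 0"
    using power_CARD_eq_same[of w] q(2) by (simp add: f_def)
  have "(\<Sum>k<s. f k) ^ (q ^ 2) = (\<Sum>k<s. f k ^ (q ^ 2))"
    by (rule sum_power_primepow[OF q])
  also have "\<dots> = (\<Sum>k<s. f (Suc k))"
    by (simp add: f_def mult.commute flip: power_mult power_add)
  also have "\<dots> = (\<Sum>k<s. f k)"
    using sum.lessThan_Suc_shift[of f s] \<open>f s = f 0\<close> by simp
  finally show ?thesis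
    by (subst subfield_eq_fixed_points[OF F(1)]) (simp add: F(2) f_def)
qed

text \<open>The \<open>k\<close>-th conjugate of the vector of all
  \<open>\<gamma> * \<beta> i ^ e\<close> is a scalar multiple of the generator with exponent
  \<open>q ^ (2 * k) * e mod n\<close>, which stays in \<open>\<Delta>\<close>.\<close>

lemma trace_codeword_in_subcode:
  fixes \<beta> :: "'n::finite \<Rightarrow> 'a::{field,finite}"
  assumes q: "primepow q" "CARD('a) = q ^ (2 * s)"
    and F: "is_subfield F" "card F = q ^ 2"
    and \<beta>: "\<And>i. \<beta> i ^ n = 1"
    and closed: "\<And>e k. e \<in> \<Delta> \<Longrightarrow> q ^ (2 * k) * e mod n \<in> \<Delta>"
    and e: "e \<in> \<Delta>"
  shows "(\<chi> i. \<Sum>k<s. (\<gamma> * \<beta> i ^ e) ^ (q ^ (2 * k))) \<in> subfield_subcode F (eval_code \<beta> \<Delta>)"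
    (is "?x \<in> _")
proof -
  have "?x = (\<Sum>k<s. \<gamma> ^ (q ^ (2 * k)) *s (\<chi> i. \<beta> i ^ (q ^ (2 * k) * e mod n)))"
    by (simp add: vec_eq_iff power_mod_exponent[OF \<beta>] power_mult_distrib mult.commute
        flip: power_mult)
  also have "\<dots> \<in> eval_code \<beta> \<Delta>"
    unfolding eval_code_def
    by (intro vec.span_sum vec.span_scale vec.span_base imageI closed e)
  finally show ?thesis
    using trace_in_subfield[OF q F] by (simp add: subfield_subcode_def)
qed

text \<open>The trace codewords of \<open>\<gamma>\<close>, \<open>\<delta>\<close> at the exponents \<open>e\<close>, \<open>e'\<close> have a Hermitian product that is a
  polynomial in \<open>\<gamma>\<close> and \<open>\<delta>\<close> of degree less than the field size in either variable; the
  coefficient at \<open>\<gamma> * \<delta> ^ q\<close> is \<open>n\<close>, so some product does not vanish.\<close>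

lemma exists_nonorthogonal_codewords:
  fixes \<beta> :: "'n::finite \<Rightarrow> 'a::{field,finite}"
  assumes q: "primepow q" "CARD('a) = q ^ (2 * s)" and s: "s > 0"
    and F: "is_subfield F" "card F = q ^ 2"
    and n: "CARD('n) = n" "n dvd q ^ (2 * s) - 1"
    and \<beta>: "bij_betw \<beta> UNIV {x. x ^ n = 1}"
    and closed: "\<And>e k. e \<in> \<Delta> \<Longrightarrow> q ^ (2 * k) * e mod n \<in> \<Delta>"
    and e: "e \<in> \<Delta>" and e': "e' \<in> \<Delta>" and dvd: "n dvd e + q * e'"
  shows "\<not> hermitian_self_orthogonal q (subfield_subcode F (eval_code \<beta> \<Delta>))"
proof
  assume ortho: "hermitian_self_orthogonal q (subfield_subcode F (eval_code \<beta> \<Delta>))"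
  have q1: "q > 1"
    using primepow_gt_Suc_0[OF q(1)] by simp
  have \<beta>n: "\<beta> i ^ n = 1" for i
    using \<beta> by (auto simp: bij_betw_def)
  define S where "S k l = (\<Sum>i\<in>UNIV. \<beta> i ^ (e * q ^ (2 * k) + e' * q ^ (2 * l + 1)))" for k l
  have S00: "S 0 0 \<noteq> 0"
  proof -
    have "\<beta> i ^ (e + q * e') = 1" for i
      using dvd \<beta>n[of i] by (auto elim!: dvdE simp: power_mult)
    then have "S 0 0 = of_nat n"
      by (simp add: S_def mult.commute n(1))
    \<comment> \<open>\<open>n\<close> divides \<open>CARD('a) - 1\<close>, and
      \<open>CARD('a)\<close> is zero in the field.\<close>
    moreover have "of_nat n \<noteq> (0 :: 'a)"
    proof
      assume 0: "of_nat n = (0 :: 'a)"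
      obtain m where "q ^ (2 * s) - 1 = n * m"
        using n(2) by (auto elim!: dvdE)
      then have "CARD('a) = n * m + 1"
        using q(2) q1 by (metis Suc_eq_plus1 Suc_pred' gr_zeroI not_one_less_zero power_eq_0_iff)
      then have "of_nat CARD('a) = (1 :: 'a)"
        using 0 by simp
      then show False
        using of_nat_CARD_eq_0[where ?'a = 'a] by simp
    qed
    ultimately show ?thesis by simp
  qed
  have prod0: "(\<Sum>k<s. (\<Sum>l<s. S k l * \<delta> ^ (q ^ (2 * l + 1))) * \<gamma> ^ (q ^ (2 * k))) = 0" for \<gamma> \<delta>
  proof -
    let ?x = "\<lambda>i. \<Sum>k<s. (\<gamma> * \<beta> i ^ e) ^ (q ^ (2 * k))"
    let ?y = "\<lambda>i. \<Sum>l<s. (\<delta> * \<beta> i ^ e') ^ (q ^ (2 * l))"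
    have y: "?y i ^ q = (\<Sum>l<s. \<delta> ^ (q ^ (2 * l + 1)) * \<beta> i ^ (e' * q ^ (2 * l + 1)))" for i
    proof -
      have "?y i ^ q = (\<Sum>l<s. ((\<delta> * \<beta> i ^ e') ^ (q ^ (2 * l))) ^ q)"
        using sum_power_primepow[OF q, of "\<lambda>l. (\<delta> * \<beta> i ^ e') ^ (q ^ (2 * l))" "{..<s}" 1] by simp
      also have "\<dots> = (\<Sum>l<s. \<delta> ^ (q ^ (2 * l + 1)) * \<beta> i ^ (e' * q ^ (2 * l + 1)))"
        by (simp add: power_mult_distrib mult_ac flip: power_mult)
      finally show ?thesis .
    qed
    have "0 = (\<Sum>i\<in>UNIV. ?x i * ?y i ^ q)"
      using ortho trace_codeword_in_subcode[OF q F \<beta>n closed e, of \<gamma>]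
        trace_codeword_in_subcode[OF q F \<beta>n closed e', of \<delta>]
      unfolding hermitian_self_orthogonal_def by force
    also have "\<dots> = (\<Sum>i\<in>UNIV. \<Sum>k<s. \<Sum>l<s. \<gamma> ^ (q ^ (2 * k)) * \<delta> ^ (q ^ (2 * l + 1)) *
        \<beta> i ^ (e * q ^ (2 * k) + e' * q ^ (2 * l + 1)))"
      unfolding y
      by (simp add: sum_product power_mult_distrib power_add mult_ac flip: power_mult)
    also have "\<dots> = (\<Sum>k<s. \<Sum>l<s. \<Sum>i\<in>UNIV. \<gamma> ^ (q ^ (2 * k)) * \<delta> ^ (q ^ (2 * l + 1)) *
        \<beta> i ^ (e * q ^ (2 * k) + e' * q ^ (2 * l + 1)))"
      by (subst sum.swap, subst sum.swap) simp
    also have "\<dots> = (\<Sum>k<s. (\<Sum>l<s. S k l * \<delta> ^ (q ^ (2 * l + 1))) * \<gamma> ^ (q ^ (2 * k)))"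
      by (simp add: S_def sum_distrib_left sum_distrib_right mult_ac)
    finally show ?thesis by simp
  qed
  \<comment> \<open>\<open>\<delta>\<close> is fixed first, making the coefficient at
    \<open>\<gamma> ^ 1\<close> nonzero; then the same argument applies to the polynomial in
    \<open>\<gamma>\<close>.\<close>
  have "\<exists>\<delta>. (\<Sum>l<s. S 0 l * \<delta> ^ (q ^ (2 * l + 1))) \<noteq> 0"
    by (rule monomial_sum_nonzero[of _ _ 0])
       (use q1 s S00 in \<open>auto simp: q(2) inj_on_def simp del: power_Suc
         intro!: power_strict_increasing\<close>)
  then obtain \<delta> where \<delta>: "(\<Sum>l<s. S 0 l * \<delta> ^ (q ^ (2 * l + 1))) \<noteq> 0" by blast
  have "\<exists>\<gamma>. (\<Sum>k<s. (\<Sum>l<s. S k l * \<delta> ^ (q ^ (2 * l + 1))) * \<gamma> ^ (q ^ (2 * k))) \<noteq> 0"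
    by (rule monomial_sum_nonzero[of _ _ 0])
       (use q1 s \<delta> in \<open>auto simp: q(2) inj_on_def simp del: power_Suc
         intro!: power_strict_increasing\<close>)
  then show False
    using prod0 by blast
qed

lemma hermitian_self_orthogonal_iff:
  fixes \<beta> :: "'n::finite \<Rightarrow> 'a::{field,finite}"
  assumes q: "primepow q" "CARD('a) = q ^ (2 * s)" and s: "s > 0"
    and F: "is_subfield F" "card F = q ^ 2"
    and n: "CARD('n) = n" "n dvd q ^ (2 * s) - 1"
    and \<beta>: "bij_betw \<beta> UNIV {x. x ^ n = 1}"
    and closed: "\<And>e k. e \<in> \<Delta> \<Longrightarrow> q ^ (2 * k) * e mod n \<in> \<Delta>"
  shows "hermitian_self_orthogonal q (subfield_subcode F (eval_code \<beta> \<Delta>)) \<longleftrightarrow>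
    (\<forall>e\<in>\<Delta>. \<forall>e'\<in>\<Delta>. \<not> n dvd e + q * e')"
proof
  assume *: "\<forall>e\<in>\<Delta>. \<forall>e'\<in>\<Delta>. \<not> n dvd e + q * e'"
  have card: "card {x::'a. x ^ n = 1} = n"
    using bij_betw_same_card[OF \<beta>] n(1) by simp
  \<comment> \<open>\<open>\<beta>\<close> lists every \<open>n\<close>-th root of unity once, so
    the coordinate sum is a power sum over all of them.\<close>
  have "(\<Sum>i\<in>UNIV. \<beta> i ^ (e + q * e')) = 0" if "e \<in> \<Delta>" "e' \<in> \<Delta>" for e e'
    using sum.reindex_bij_betw[OF \<beta>, of "\<lambda>x. x ^ (e + q * e')"]
      sum_roots_of_unity_power[OF card, of "e + q * e'"] * that by simp
  then show "hermitian_self_orthogonal q (subfield_subcode F (eval_code \<beta> \<Delta>))"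
    unfolding hermitian_self_orthogonal_def subfield_subcode_def
    by (intro ballI hermitian_form_eval_code[OF q, where \<Delta> = \<Delta>]) auto
qed (use exists_nonorthogonal_codewords[OF q s F n \<beta> closed] in blast)

section \<open>Cyclotomic cosets\<close>

lemma finite_cyclotomic_coset:
  assumes "n > 0"
  shows "finite (cyclotomic_coset q n e)"
  by (rule finite_subset[of _ "{..<n}"]) (use assms in \<open>auto simp: cyclotomic_coset_def\<close>)

lemma cyclotomic_coset_self:
  assumes "e < n"
  shows "e \<in> cyclotomic_coset q n e"
  using assms by (force simp: cyclotomic_coset_def intro: exI[of _ 0])

lemma cyclotomic_coset_closed:
  assumes "e \<in> cyclotomic_coset q n b"
  shows "q ^ (2 * k) * e mod n \<in> cyclotomic_coset q n b"
proof -
  obtain i where "e = q ^ (2 * i) * b mod n"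
    using assms by (auto simp: cyclotomic_coset_def)
  then have "q ^ (2 * k) * e mod n = q ^ (2 * (k + i)) * b mod n"
    by (simp add: mod_mult_right_eq power_add mult.assoc distrib_left)
  then show ?thesis
    unfolding cyclotomic_coset_def by blast
qed

text \<open>Modulo \<open>n\<close>, \<open>q ^ (2 * ((s - 1) * i))\<close> inverts
  \<open>q ^ (2 * i)\<close>.\<close>

lemma cyclotomic_coset_sym:
  assumes ord: "[q ^ (2 * s) = 1] (mod n)" and s: "s > 0"
    and e: "e < n" and b: "b \<in> cyclotomic_coset q n e"
  shows "e \<in> cyclotomic_coset q n b"
proof -
  obtain i where i: "b = q ^ (2 * i) * e mod n"
    using b by (auto simp: cyclotomic_coset_def)
  have "2 * ((s - 1) * i) + 2 * i = 2 * s * i"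
    using s by (cases s) (auto simp: algebra_simps)
  then have "q ^ (2 * ((s - 1) * i)) * b mod n = (q ^ (2 * s)) ^ i * e mod n"
    by (simp add: i mod_mult_right_eq mult.assoc[symmetric] flip: power_add power_mult)
  also have "\<dots> = e mod n"
    using cong_mult[OF cong_pow[OF ord, of i] cong_refl[of e]] by (simp add: cong_def)
  finally have "e = q ^ (2 * ((s - 1) * i)) * b mod n"
    using e by simp
  then show ?thesis
    unfolding cyclotomic_coset_def by blast
qed

lemma cyclotomic_coset_pos:
  assumes "coprime q n" and "0 < e" and "e < n" and "b \<in> cyclotomic_coset q n e"
  shows "0 < b"
proof (rule ccontr)
  assume "\<not> 0 < b"
  then obtain i where "n dvd q ^ (2 * i) * e"
    using assms(4) by (auto simp: cyclotomic_coset_def dvd_eq_mod_eq_0)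
  then have "n dvd e"
    using assms(1) by (simp add: coprime_dvd_mult_right_iff coprime_commute)
  then show False
    using assms(2,3) by (auto dest: dvd_imp_le)
qed

text \<open>This places the extremal pair in the defining set. The minimum of the coset of
  \<open>e\<close> is some \<open>a t \<le> e \<le> a \<tau>\<close>, so
  \<open>t \<le> \<tau>\<close>; and \<open>t \<noteq> 0\<close> because the coset of a positive
  \<open>e\<close> avoids 0.\<close>

lemma mem_cyclotomic_cosets_leI:
  fixes a :: "nat \<Rightarrow> nat"
  assumes ord: "[q ^ (2 * s) = 1] (mod n)" and s: "s > 0" and cop: "coprime q n"
    and a0: "a 0 = 0" and mono: "strict_mono_on {0..\<nu>} a"
    and range: "a ` {0..\<nu>} = Min ` cyclotomic_cosets q n"
    and \<tau>: "\<tau> \<le> \<nu>" and e: "0 < e" "e < n" "e \<le> a \<tau>"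
  shows "e \<in> (\<Union>t\<in>{1..\<tau>}. cyclotomic_coset q n (a t))"
proof -
  let ?m = "Min (cyclotomic_coset q n e)"
  have fin: "finite (cyclotomic_coset q n e)" "e \<in> cyclotomic_coset q n e"
    using e by (auto intro: finite_cyclotomic_coset cyclotomic_coset_self)
  then have m: "?m \<in> cyclotomic_coset q n e" "?m \<le> e"
    by (auto intro: Min_in)
  have "?m \<in> a ` {0..\<nu>}"
    unfolding range cyclotomic_cosets_def using e by auto
  then obtain t where t: "t \<le> \<nu>" "?m = a t" by auto
  have "t \<le> \<tau>"
  proof (rule ccontr)
    assume "\<not> t \<le> \<tau>"
    then have "a \<tau> < a t"
      using mono t(1) \<tau> by (intro strict_mono_onD[OF mono]) auto
    then show False
      using m(2) t(2) e(3) by simp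
  qed
  moreover have "t \<noteq> 0"
    using cyclotomic_coset_pos[OF cop e(1,2) m(1)] t(2) a0 by (metis less_irrefl)
  moreover have "e \<in> cyclotomic_coset q n (a t)"
    using cyclotomic_coset_sym[OF ord s e(2) m(1)] t(2) by simp
  ultimately show ?thesis by (intro UN_I[of t]) auto
qed

section \<open>The extremal congruence\<close>

lemma no_small_solution:
  fixes q s n2 j a b :: nat
  defines "c \<equiv> (q - 1) * n2 div (q ^ (s - 1) + 1)"
  assumes q: "q \<ge> 2" and s: "s > 0" and j: "j < s" and pos: "0 < a"
    and ab: "a < q * n2 - c" "b < q * n2 - c"
  shows "\<not> (q ^ s + 1) * n2 dvd a + q ^ j * b"
proof
  define Q where "Q = q ^ (s - 1)"
  have Q: "q ^ s = q * Q" "Q > 0"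
    using q s by (cases s; simp add: Q_def)+
  assume "(q ^ s + 1) * n2 dvd a + q ^ j * b"
  then obtain k where k: "a + q ^ j * b = (q * Q + 1) * n2 * k"
    by (auto simp: Q elim: dvdE)
  have "k > 0"
    using k pos by (cases k) auto
  then have ge: "a + q ^ j * b \<ge> (q * Q + 1) * n2"
    unfolding k by simp
  have bound: "a + q ^ j * b < q * n2 + q ^ j * (q * n2)"
    using ab by (intro add_less_le_mono mult_left_mono) auto
  \<comment> \<open>For smaller \<open>j\<close>,
    \<open>q + q ^ (j + 1) \<le> q + Q \<le> q * Q + 1\<close>, so the sum stays below the
    modulus.\<close>
  have "j = s - 1"
  proof (rule ccontr)
    assume "j \<noteq> s - 1"
    then have "q ^ Suc j \<le> Q"
      unfolding Q_def using j q by (intro power_increasing) auto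
    then have "q + q ^ j * q \<le> q + Q"
      by (simp add: mult.commute)
    also have "\<dots> \<le> q * Q + 1"
      using q Q(2) by (cases q; cases Q) (auto simp: algebra_simps)
    finally have "(q + q ^ j * q) * n2 \<le> (q * Q + 1) * n2"
      by (rule mult_right_mono) simp
    then show False
      using ge bound by (simp add: algebra_simps)
  qed
  then have j': "q ^ j = Q"
    by (simp add: Q_def)
  \<comment> \<open>Twice the modulus is too large:
    \<open>q + q * Q < 2 * (q * Q + 1)\<close>.\<close>
  have "k = 1"
  proof (rule ccontr)
    assume "k \<noteq> 1"
    then have "2 \<le> k" using \<open>k > 0\<close> by simp
    then have "(q * Q + 1) * n2 * 2 \<le> a + q ^ j * b"
      unfolding k by (rule mult_left_mono) simp
    moreover obtain R where "Q = Suc R"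
      using Q(2) gr0_implies_Suc by blast
    ultimately show False
      using bound j' by (simp add: algebra_simps)
  qed
  define d where "d = q * n2 - b"
  have b: "q * n2 = b + d"
    using ab by (simp add: d_def)
  have "a + Q * b = (q * n2) * Q + n2"
    using k \<open>k = 1\<close> j' by (simp add: algebra_simps)
  then have a: "a = n2 + Q * d"
    unfolding b by (simp add: algebra_simps)
  \<comment> \<open>The bound on \<open>b\<close> pushes \<open>d\<close> past \<open>c\<close>. As
    \<open>c\<close> is a floor, \<open>(q - 1) * n2 \<le> Q * (c + 1) + c\<close>, hence
    \<open>a \<ge> n2 + Q * (c + 1) \<ge> q * n2 - c\<close>, against the bound on
    \<open>a\<close>.\<close>
  have "c + 1 \<le> d"
    using ab by (simp add: d_def)
  then have "Q * (c + 1) \<le> Q * d"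
    by (rule mult_left_mono) simp
  moreover have "(q - 1) * n2 < (Q + 1) * (c + 1)"
    unfolding c_def Q_def using dividend_less_div_times[of "q ^ (s - 1) + 1" "(q - 1) * n2"]
    by (simp add: algebra_simps)
  moreover have "q * n2 = n2 + (q - 1) * n2"
    using q by (cases q) auto
  ultimately show False
    using a ab(1) by (simp add: algebra_simps)
qed

text \<open>If \<open>a + q ^ j * b\<close> vanishes modulo \<open>n\<close> with \<open>j\<close> odd, then so does \<open>q ^ (2 * s - j) * a + b\<close>;
  one of \<open>j\<close> and \<open>2 * s - j\<close> is less than \<open>s\<close> because \<open>s\<close> is even.\<close>

lemma no_small_solution_cosets:
  fixes q s n2 a b :: nat
  defines "c \<equiv> (q - 1) * n2 div (q ^ (s - 1) + 1)" and "n \<equiv> (q ^ s + 1) * n2"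
  assumes q: "q \<ge> 2" and s: "s > 0" "even s" and ord: "[q ^ (2 * s) = 1] (mod n)"
    and a: "0 < a" "a < q * n2 - c" and b: "0 < b" "b < q * n2 - c"
    and e: "e \<in> cyclotomic_coset q n a" and e': "e' \<in> cyclotomic_coset q n b"
  shows "\<not> n dvd e + q * e'"
proof
  assume dvd: "n dvd e + q * e'"
  obtain i k where ik: "e = q ^ (2 * i) * a mod n" "e' = q ^ (2 * k) * b mod n"
    using e e' by (auto simp: cyclotomic_coset_def)
  have pow: "[q ^ m * x = q ^ (m mod (2 * s)) * x] (mod n)" for m x
  proof -
    have "q ^ m = (q ^ (2 * s)) ^ (m div (2 * s)) * q ^ (m mod (2 * s))"
      by (simp flip: power_mult power_add)
    also have "[\<dots> = 1 ^ (m div (2 * s)) * q ^ (m mod (2 * s))] (mod n)"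
      by (intro cong_mult cong_pow ord cong_refl)
    finally show ?thesis
      by (intro cong_mult cong_refl) simp
  qed
  have "[e = q ^ (2 * i) * a] (mod n)" "[e' = q ^ (2 * k) * b] (mod n)"
    by (simp_all add: ik cong_def)
  then have "[e + q * e' = q ^ (2 * i) * a + q * (q ^ (2 * k) * b)] (mod n)"
    by (intro cong_add cong_mult cong_refl)
  then have "n dvd q ^ (2 * i) * a + q * (q ^ (2 * k) * b)"
    using dvd cong_dvd_iff by blast
  then have 1: "n dvd q ^ (2 * i) * a + q ^ (2 * k + 1) * b"
    by (simp add: mult.assoc)
  \<comment> \<open>Multiplying by \<open>q ^ (2 * ((s - 1) * i))\<close> makes the exponent at
    \<open>a\<close> a multiple of \<open>2 * s\<close>, so that power becomes 1. The exponent
    \<open>m\<close> at \<open>b\<close> is odd and stays odd when reduced modulo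
    \<open>2 * s\<close>.\<close>
  define m where "m = 2 * k + 1 + 2 * ((s - 1) * i)"
  have i: "2 * ((s - 1) * i) + 2 * i = 2 * s * i"
    using s(1) by (cases s) (auto simp: algebra_simps)
  have "n dvd q ^ (2 * ((s - 1) * i)) * (q ^ (2 * i) * a + q ^ (2 * k + 1) * b)"
    using 1 by (rule dvd_mult)
  also have "\<dots> = q ^ (2 * s * i) * a + q ^ m * b"
    unfolding i[symmetric] m_def power_add by (simp only: algebra_simps)
  finally have 2: "n dvd q ^ (2 * s * i) * a + q ^ m * b" .
  define j where "j = m mod (2 * s)"
  have "[q ^ (2 * s * i) * a + q ^ m * b = a + q ^ j * b] (mod n)"
    using cong_add[OF pow[of "2 * s * i" a] pow[of m b]] by (simp add: j_def)
  then have 3: "n dvd a + q ^ j * b"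
    using 2 cong_dvd_iff by blast
  have "odd m" by (simp add: m_def)
  then have j: "odd j" "j < 2 * s"
    using s(1) by (auto simp: j_def dvd_mod_iff)
  show False
  proof (cases "j < s")
    case True
    then show False
      using no_small_solution[OF q s(1) _ a(1), of j n2 b] a b 3 by (simp add: c_def n_def)
  next
    case False
    have "j \<noteq> s"
      using j(1) s(2) by auto
    then have less: "2 * s - j < s"
      using False j(2) by linarith
    have "n dvd q ^ (2 * s - j) * (a + q ^ j * b)"
      using 3 by (rule dvd_mult)
    also have "\<dots> = q ^ (2 * s - j) * a + q ^ (2 * s) * b"
      using j(2) by (simp add: distrib_left mult.assoc[symmetric] flip: power_add)
    finally have 4: "n dvd q ^ (2 * s - j) * a + q ^ (2 * s) * b" .
    have "[q ^ (2 * s - j) * a + q ^ (2 * s) * b = q ^ (2 * s - j) * a + b] (mod n)"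
      using cong_add[OF cong_refl pow[of "2 * s" b], of "q ^ (2 * s - j) * a"] by simp
    then have "n dvd b + q ^ (2 * s - j) * a"
      using 4 cong_dvd_iff by (metis add.commute)
    then show False
      using no_small_solution[OF q s(1) less b(1), of n2 a] a b
      by (simp add: c_def n_def)
  qed
qed

lemma min_floor_eq_div:
  fixes q n2 Q :: nat
  assumes "q \<ge> 2" and "n2 > 0" and "Q > 0"
  shows "min \<lfloor>(real q - 1) * real n2 / (real Q + 1)\<rfloor> \<lfloor>((real q - 1) * real n2 - 1) / real Q\<rfloor> =
    int ((q - 1) * n2 div (Q + 1))"
proof -
  define m where "m = (q - 1) * n2"
  have m: "(real q - 1) * real n2 = real m" "m > 0"
    using assms by (auto simp: m_def of_nat_diff)
  have 1: "\<lfloor>real m / (real Q + 1)\<rfloor> = int (m div (Q + 1))"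
    using floor_divide_of_nat_eq[of m "Q + 1", where ?'a = real] by (simp add: add_ac)
  have "m div (Q + 1) * (Q + 1) \<le> m"
    by (rule div_times_less_eq_dividend)
  \<comment> \<open>A positive quotient \<open>t\<close> gives
    \<open>t * Q + 1 \<le> t * (Q + 1) \<le> m\<close>; for quotient 0 this is \<open>m > 0\<close>.
    Hence the second floor is at least the first.\<close>
  then have "m div (Q + 1) * Q + 1 \<le> m"
    using m(2) by (cases "m div (Q + 1)") (auto simp: algebra_simps)
  then have "real (m div (Q + 1) * Q + 1) \<le> real m"
    by (simp only: of_nat_le_iff)
  then have "int (m div (Q + 1)) \<le> \<lfloor>(real m - 1) / real Q\<rfloor>"
    using assms(3) by (simp add: le_floor_iff field_simps)
  then show ?thesis
    unfolding m 1 by (simp add: m_def)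
qed

section \<open>The bound for BCH codes\<close>

theorem proposition3p1:
  fixes q s n1 n2 \<nu> \<tau> :: nat
    and a :: "nat \<Rightarrow> nat"
    and \<beta> :: "'n::finite \<Rightarrow> 'a::{field,finite}"
    and F :: "'a set"
  assumes "primepow q"
    and "s \<ge> 2" and "even s"
    and "n2 > 0" and "n2 dvd q ^ s - 1"
    and "n1 = (q ^ s + 1) * n2"
    and "CARD('a) = q ^ (2 * s)"
    and "is_subfield F" and "card F = q ^ 2"
    and "CARD('n) = n1"
    and "bij_betw \<beta> UNIV {x. x ^ n1 = 1}"
    and "a 0 = 0" and "strict_mono_on {0..\<nu>} a"
    and "a ` {0..\<nu>} = Min ` cyclotomic_cosets q n1"
    and "1 \<le> \<tau>" and "\<tau> \<le> \<nu>"
  shows "hermitian_self_orthogonal q (BCH_code F \<beta> q a \<tau>) \<longleftrightarrow>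
    int (a \<tau>) \<le> int q * int n2
      - min \<lfloor>(real q - 1) * real n2 / (real q ^ (s - 1) + 1)\<rfloor>
            \<lfloor>((real q - 1) * real n2 - 1) / real q ^ (s - 1)\<rfloor>
      - 1"
proof -
  define c where "c = (q - 1) * n2 div (q ^ (s - 1) + 1)"
  define \<Delta> where "\<Delta> = (\<Union>t\<in>{1..\<tau>}. cyclotomic_coset q n1 (a t))"
  have q: "q \<ge> 2"
    using primepow_gt_Suc_0[OF assms(1)] by simp
  have s: "s > 0" using assms(2) by simp
  have "q ^ (2 * s) - 1 = (q ^ s + 1) * (q ^ s - 1)"
    by (simp add: algebra_simps mult_2_right flip: power_add)
  then have dvd: "n1 dvd q ^ (2 * s) - 1"
    using assms(5) unfolding assms(6) by (simp only: mult_dvd_mono dvd_refl)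
  have ord: "[q ^ (2 * s) = 1] (mod n1)"
    using dvd q by (subst cong_altdef_nat) auto
  have cop: "coprime q n1"
  proof -
    have "coprime (q ^ (2 * s)) n1"
      using cong_imp_coprime[OF cong_sym[OF ord]] by simp
    then show ?thesis using s by simp
  qed
  have closed: "q ^ (2 * k) * e mod n1 \<in> \<Delta>" if "e \<in> \<Delta>" for e k
    using that cyclotomic_coset_closed unfolding \<Delta>_def by blast
  have code: "BCH_code F \<beta> q a \<tau> = subfield_subcode F (eval_code \<beta> \<Delta>)"
    by (simp add: BCH_code_def \<Delta>_def assms(10))
  have c_less: "c < q * n2"
  proof -
    have "c \<le> (q - 1) * n2"
      unfolding c_def by (rule div_le_dividend)
    also have "\<dots> < q * n2"
      using q assms(4) by simp
    finally show ?thesis .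
  qed
  have "hermitian_self_orthogonal q (BCH_code F \<beta> q a \<tau>) \<longleftrightarrow>
      (\<forall>e\<in>\<Delta>. \<forall>e'\<in>\<Delta>. \<not> n1 dvd e + q * e')"
    unfolding code
    by (rule hermitian_self_orthogonal_iff[OF assms(1,7) s assms(8,9,10) dvd assms(11) closed])
  also have "\<dots> \<longleftrightarrow> a \<tau> < q * n2 - c"
  proof
    assume less: "a \<tau> < q * n2 - c"
    have *: "0 < a t \<and> a t < q * n2 - c" if "t \<in> {1..\<tau>}" for t
    proof -
      have "a 0 < a t"
        using assms(13) that assms(16) by (auto simp: strict_mono_on_def)
      moreover have "a t \<le> a \<tau>"
        using strict_mono_on_leD[OF assms(13)] that assms(16) by simp
      ultimately show ?thesis
        using less assms(12) by simp
    qed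
    show "\<forall>e\<in>\<Delta>. \<forall>e'\<in>\<Delta>. \<not> n1 dvd e + q * e'"
    proof (intro ballI)
      fix e e' assume "e \<in> \<Delta>" "e' \<in> \<Delta>"
      then obtain t t' where t: "t \<in> {1..\<tau>}" "e \<in> cyclotomic_coset q n1 (a t)"
        and t': "t' \<in> {1..\<tau>}" "e' \<in> cyclotomic_coset q n1 (a t')"
        unfolding \<Delta>_def by blast
      show "\<not> n1 dvd e + q * e'"
        using ord t(2) t'(2) *[OF t(1)] *[OF t'(1)] unfolding c_def assms(6)
        by (intro no_small_solution_cosets[OF q s assms(3), where a = "a t" and b = "a t'"]) blast+
    qed
  next
    assume none: "\<forall>e\<in>\<Delta>. \<forall>e'\<in>\<Delta>. \<not> n1 dvd e + q * e'"
    show "a \<tau> < q * n2 - c"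
    proof (rule ccontr)
      assume large: "\<not> a \<tau> < q * n2 - c"
      define Q where "Q = q ^ (s - 1)"
      have Q: "q ^ s = q * Q" "Q > 0"
        using q s by (cases s; simp add: Q_def)+
      \<comment> \<open>The extremal pair: \<open>d + Q * b = n1\<close>, and
        \<open>d \<le> b\<close> by the choice of \<open>c\<close>. Since
        \<open>b \<le> a \<tau>\<close>, both lie in \<open>\<Delta>\<close>.\<close>
      define b where "b = q * n2 - c"
      define d where "d = n2 + Q * c"
      have bc: "q * n2 = b + c"
        using c_less by (simp add: b_def)
      have "c * (Q + 1) \<le> (q - 1) * n2"
        unfolding c_def Q_def by (rule div_times_less_eq_dividend)
      then have "d \<le> b"
        using q by (cases q) (simp_all add: d_def b_def algebra_simps)
      obtain R where "Q = Suc R"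
        using Q(2) gr0_implies_Suc by blast
      then have "b < n1"
        using assms(4) by (simp add: b_def assms(6) Q algebra_simps)
      have "b \<in> \<Delta>" "d \<in> \<Delta>"
        unfolding \<Delta>_def
        using mem_cyclotomic_cosets_leI[OF ord s cop assms(12-14,16)] large c_less \<open>b < n1\<close> \<open>d \<le> b\<close>
          assms(4)
        by (auto simp: b_def d_def)
      \<comment> \<open>As \<open>s - 1\<close> is odd, \<open>Q = q * q ^ (2 * k)\<close>; the even
        power moves \<open>b\<close> within its coset, leaving the single factor \<open>q\<close> of
        the Hermitian form.\<close>
      define k where "k = (s - 2) div 2"
      have k: "s - 1 = 2 * k + 1"
        using assms(2,3) by (auto simp: k_def elim!: evenE)
      define e' where "e' = q ^ (2 * k) * b mod n1"
      have "[d + q * e' = d + q * (q ^ (2 * k) * b)] (mod n1)"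
        unfolding e'_def by (intro cong_add cong_mult cong_refl) (simp add: cong_def)
      also have "d + q * (q ^ (2 * k) * b) = d + Q * b"
        unfolding Q_def k by simp
      also have "\<dots> = n2 + Q * (q * n2)"
        unfolding bc by (simp add: d_def algebra_simps)
      also have "\<dots> = n1"
        by (simp add: assms(6) Q algebra_simps)
      finally have "n1 dvd d + q * e'"
        by (simp add: cong_def dvd_eq_mod_eq_0)
      then show False
        using none \<open>d \<in> \<Delta>\<close> closed[OF \<open>b \<in> \<Delta>\<close>, of k] by (auto simp: e'_def)
    qed
  qed
  \<comment> \<open>By \<open>c < q * n2\<close> the subtraction on naturals does not truncate; the
    strict inequality accounts for the final \<open>- 1\<close>.\<close>
  also have "\<dots> \<longleftrightarrow> int (a \<tau>) \<le> int q * int n2 - int c - 1"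
    using c_less by (simp add: less_diff_conv algebra_simps flip: of_nat_mult) linarith
  finally show ?thesis
    using min_floor_eq_div[of q n2 "q ^ (s - 1)"] q assms(4) by (simp add: c_def)
qed

end
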